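(* Let $D=\mathrm{Diag}(d_1,\dots,d_n)$ be a diagonal matrix with $d_1,\dots,d_n>0$ and let $r\in\mathbb N$. Then, for every real symmetric $n\times n$ matrix $M$, $$M\in\widetilde{\mathcal Q}_n^{(r)}\iff DMD\in\widetilde{\mathcal Q}_n^{(r)}.$$
   Context: $\mathbb N=\{0,1,2,\dots\}$. $\mathcal S^n$ is the space of real symmetric $n\times n$ matrices. For $\beta\in\mathbb N^n$ put $|\beta|=\sum_i\beta_i$ and $x^\beta=x_1^{\beta_1}\cdots x_n^{\beta_n}$. For $n,r\in\mathbb N$: $\mathcal N_{n,r}$ is the set of homogeneous polynomials of degree $r$ in $x_1,\dots,x_n$ with nonnegative coefficients (including $0$); $\mathcal H_{n,r}$ is the cone of homogeneous polynomials of degree $r+2$ (including $0$) of the form $\sum_{\beta\in\mathbb N^n,\ |\beta|\in\{r,r+2\}}x^\beta\sigma_\beta$, where each $\sigma_\beta$ is a sum of squares of real polynomials of degree at most $r+2-|\beta|$. $\|p\|_1$ is the sum of the absolute values of the coefficients of $p$. Define $$\widetilde{\mathcal Q}_n^{(r)}=\{M\in\mathcal S^n:\ p\cdot x^TMx\in\mathcal H_{n,r}\text{ for some }p\in\mathcal N_{n,r}\text{ with }\|p\|_1=1\}.$$ *)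

theory Defs
  imports Complex_Main "HOL-Library.Poly_Mapping" "Jordan_Normal_Form.Matrix"
begin

(* A monomial x^beta is its exponent vector beta, a polynomial is its finitely supported
   coefficient function; multiplication of polynomials is the convolution product of
   Poly_Mapping. The variables x_1, ..., x_n are indexed by 0, ..., n - 1. *)

type_synonym monom = "nat \<Rightarrow>\<^sub>0 nat"
type_synonym mpoly = "monom \<Rightarrow>\<^sub>0 real"

definition exponents :: "nat \<Rightarrow> monom set" where
  "exponents n = {\<beta>. Poly_Mapping.keys \<beta> \<subseteq> {..<n}}"

definition mdeg :: "monom \<Rightarrow> nat" where
  "mdeg \<beta> = (\<Sum>i\<in>Poly_Mapping.keys \<beta>. Poly_Mapping.lookup \<beta> i)"

definition polys :: "nat \<Rightarrow> mpoly set" where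
  "polys n = {p. Poly_Mapping.keys p \<subseteq> exponents n}"

definition polys_le :: "nat \<Rightarrow> nat \<Rightarrow> mpoly set" where
  "polys_le n k = {p \<in> polys n. \<forall>\<beta>\<in>Poly_Mapping.keys p. mdeg \<beta> \<le> k}"

(* includes the zero polynomial *)
definition homogeneous_polys :: "nat \<Rightarrow> nat \<Rightarrow> mpoly set" where
  "homogeneous_polys n k = {p \<in> polys n. \<forall>\<beta>\<in>Poly_Mapping.keys p. mdeg \<beta> = k}"

definition coeff_norm1 :: "mpoly \<Rightarrow> real" where
  "coeff_norm1 p = (\<Sum>\<beta>\<in>Poly_Mapping.keys p. \<bar>Poly_Mapping.lookup p \<beta>\<bar>)"

(* The degree bound is on the sum of squares itself, so that each product x^beta sigma_beta
   in H_polys has degree at most r + 2. Bounding the degrees of the squared polynomials by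
   r + 2 - |beta| instead gives the same set H_polys: the part of degree r + 4 would be
   the sum of x^beta q^2 over |beta| = r, with q the quadratic parts of the squared
   polynomials; it vanishes by homogeneity of f, and evaluation at positive points
   shows that every such q is 0. *)
definition sos_le :: "nat \<Rightarrow> nat \<Rightarrow> mpoly set" where
  "sos_le n k = {s \<in> polys_le n k. \<exists>qs. set qs \<subseteq> polys n \<and> s = (\<Sum>q\<leftarrow>qs. q\<^sup>2)}"

definition N_polys :: "nat \<Rightarrow> nat \<Rightarrow> mpoly set" where
  "N_polys n r = {p \<in> homogeneous_polys n r. \<forall>\<beta>. Poly_Mapping.lookup p \<beta> \<ge> 0}"

definition H_polys :: "nat \<Rightarrow> nat \<Rightarrow> mpoly set" where
  "H_polys n r = {f \<in> homogeneous_polys n (r + 2).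
     \<exists>\<sigma> :: monom \<Rightarrow> mpoly.
       (\<forall>\<beta>\<in>exponents n. mdeg \<beta> \<in> {r, r + 2} \<longrightarrow> \<sigma> \<beta> \<in> sos_le n (r + 2 - mdeg \<beta>)) \<and>
       f = (\<Sum>\<beta> | \<beta> \<in> exponents n \<and> mdeg \<beta> \<in> {r, r + 2}. Poly_Mapping.single \<beta> 1 * \<sigma> \<beta>)}"

definition quad_form :: "nat \<Rightarrow> real mat \<Rightarrow> mpoly" where
  "quad_form n M = (\<Sum>i<n. \<Sum>j<n.
     Poly_Mapping.single (Poly_Mapping.single i 1 + Poly_Mapping.single j 1) (M $$ (i, j)))"

definition symmetric_mats :: "nat \<Rightarrow> real mat set" where
  "symmetric_mats n = {M \<in> carrier_mat n n. transpose_mat M = M}"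

definition Q_tilde :: "nat \<Rightarrow> nat \<Rightarrow> real mat set" where
  "Q_tilde n r = {M \<in> symmetric_mats n.
     \<exists>p\<in>N_polys n r. coeff_norm1 p = 1 \<and> p * quad_form n M \<in> H_polys n r}"

(* the sum over beta in H_polys is a genuine finite sum *)
lemma finite_exponents_mdeg: "finite {\<beta> \<in> exponents n. mdeg \<beta> \<in> {r, r + 2}}"
proof -
  let ?B = "{\<beta> \<in> exponents n. mdeg \<beta> \<in> {r, r + 2}}"
  let ?F = "{f. \<forall>i. (i \<in> {..<n} \<longrightarrow> f i \<in> {..r + 2}) \<and> (i \<notin> {..<n} \<longrightarrow> f i = (0::nat))}"
  have le: "Poly_Mapping.lookup \<beta> i \<le> mdeg \<beta>" for \<beta> i
  proof (cases "i \<in> Poly_Mapping.keys \<beta>")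
    case True
    then show ?thesis unfolding mdeg_def by (intro member_le_sum) simp_all
  next
    case False
    then show ?thesis by (simp add: in_keys_iff)
  qed
  have "Poly_Mapping.lookup ` ?B \<subseteq> ?F"
  proof (intro subsetI CollectI allI conjI impI)
    fix f i assume "f \<in> Poly_Mapping.lookup ` ?B"
    then obtain \<beta> where b: "f = Poly_Mapping.lookup \<beta>" "\<beta> \<in> exponents n" "mdeg \<beta> \<le> r + 2"
      by auto
    show "f i \<in> {..r + 2}" using le[of \<beta> i] b by simp
    show "f i = 0" if "i \<notin> {..<n}"
      using that b by (auto simp: exponents_def in_keys_iff)
  qed
  moreover have "finite ?F" by (rule finite_set_of_finite_funs) auto
  ultimately have "finite (Poly_Mapping.lookup ` ?B)" by (rule finite_subset)
  then show ?thesis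
    by (rule finite_imageD) (simp add: inj_on_def)
qed

end

theory Submission
  imports Defs
begin

text \<open>
  The rescaling of variables \<open>x\<^sub>i \<mapsto> c\<^sub>i x\<^sub>i\<close> with all \<open>c\<^sub>i > 0\<close> is a ring automorphism of the
  polynomial ring that multiplies the coefficient of each \<open>x\<^sup>\<beta>\<close> by the positive number \<open>c\<^sup>\<beta>\<close>.
  It therefore keeps the support of every polynomial (so degree bounds and homogeneity survive),
  keeps nonnegative coefficients nonnegative, and sends squares to squares. A term
  \<open>x\<^sup>\<beta> \<sigma>\<^sub>\<beta>\<close> becomes \<open>x\<^sup>\<beta>\<close> times the positive multiple \<open>c\<^sup>\<beta>\<close> of the rescaled \<open>\<sigma>\<^sub>\<beta>\<close>, and
  the multiple is absorbed into the squares through its square root; this shows that the cone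
  \<open>H_polys\<close> is stable (\<open>const_times_rescale_H_polys\<close>).

  The rescaling turns the form \<open>x\<^sup>T M x\<close> into \<open>x\<^sup>T D M D x\<close> where \<open>D = Diag(c)\<close>
  (\<open>rescale_quad_form\<close>). Hence a multiplier \<open>p\<close> that certifies \<open>M\<close> becomes, after rescaling and
  dividing by its norm, a multiplier that certifies \<open>D M D\<close>. This is one implication for
  arbitrary positive \<open>c\<close>, and the converse is the same implication for \<open>1 / c\<close>.
\<close>

section \<open>Positive rescaling of the variables\<close>

definition monom_val :: "(nat \<Rightarrow> real) \<Rightarrow> monom \<Rightarrow> real" where
  "monom_val c \<beta> = (\<Prod>i\<in>Poly_Mapping.keys \<beta>. c i ^ Poly_Mapping.lookup \<beta> i)"

definition rescale :: "(nat \<Rightarrow> real) \<Rightarrow> mpoly \<Rightarrow> mpoly" where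
  "rescale c = Poly_Mapping.mapp (\<lambda>\<beta> a. monom_val c \<beta> * a)"

lemma monom_val_superset:
  assumes "finite S" "Poly_Mapping.keys \<beta> \<subseteq> S"
  shows "monom_val c \<beta> = (\<Prod>i\<in>S. c i ^ Poly_Mapping.lookup \<beta> i)"
  unfolding monom_val_def using assms
  by (intro prod.mono_neutral_left) (auto simp: in_keys_iff)

lemma monom_val_add: "monom_val c (\<alpha> + \<beta>) = monom_val c \<alpha> * monom_val c \<beta>"
proof -
  define S where "S = Poly_Mapping.keys \<alpha> \<union> Poly_Mapping.keys \<beta>"
  have "finite S" "Poly_Mapping.keys \<alpha> \<subseteq> S" "Poly_Mapping.keys \<beta> \<subseteq> S"
    "Poly_Mapping.keys (\<alpha> + \<beta>) \<subseteq> S"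
    using Poly_Mapping.keys_add[of \<alpha> \<beta>] by (auto simp: S_def)
  then show ?thesis
    by (simp add: monom_val_superset[of S] lookup_add power_add prod.distrib)
qed

lemma monom_val_single: "monom_val c (Poly_Mapping.single i k) = c i ^ k"
  by (simp add: monom_val_superset[of "{i}"])

lemma monom_val_pos:
  assumes "\<forall>i. c i > 0"
  shows "monom_val c \<beta> > 0"
  unfolding monom_val_def using assms by (intro prod_pos) simp

lemma lookup_rescale:
  "Poly_Mapping.lookup (rescale c p) \<beta> = monom_val c \<beta> * Poly_Mapping.lookup p \<beta>"
  by (simp add: rescale_def mapp.rep_eq when_def in_keys_iff)

lemma lookup_const_times:
  "Poly_Mapping.lookup (Poly_Mapping.single 0 t * p :: mpoly) \<beta> = t * Poly_Mapping.lookup p \<beta>"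
  by (simp add: mult_map_scale_conv_mult[symmetric] Poly_Mapping.map.rep_eq when_def)

lemma keys_const_times_rescale:
  assumes "\<forall>i. c i > 0" "t > 0"
  shows "Poly_Mapping.keys (Poly_Mapping.single 0 t * rescale c p) = Poly_Mapping.keys p"
  using monom_val_pos[OF assms(1)] assms(2)
  by (auto simp: in_keys_iff lookup_const_times lookup_rescale less_le)

lemma keys_rescale:
  assumes "\<forall>i. c i > 0"
  shows "Poly_Mapping.keys (rescale c p) = Poly_Mapping.keys p"
  using keys_const_times_rescale[OF assms, where t = 1] by simp

lemma rescale_zero: "rescale c 0 = 0"
  by (rule poly_mapping_eqI) (simp add: lookup_rescale)

lemma rescale_add: "rescale c (p + q) = rescale c p + rescale c q"
  by (rule poly_mapping_eqI) (simp add: lookup_rescale lookup_add algebra_simps)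

lemma rescale_sum: "rescale c (\<Sum>a\<in>A. f a) = (\<Sum>a\<in>A. rescale c (f a))"
  by (induction A rule: infinite_finite_induct) (simp_all add: rescale_zero rescale_add)

lemma rescale_sum_list: "rescale c (\<Sum>q\<leftarrow>qs. f q) = (\<Sum>q\<leftarrow>qs. rescale c (f q))"
  by (induction qs) (simp_all add: rescale_zero rescale_add)

lemma rescale_single:
  "rescale c (Poly_Mapping.single \<beta> a) = Poly_Mapping.single \<beta> (monom_val c \<beta> * a)"
  by (rule poly_mapping_eqI) (auto simp: lookup_rescale lookup_single when_def)

lemma rescale_mult: "rescale c (p * q) = rescale c p * rescale c q"
proof -
  have expand: "p = (\<Sum>\<alpha>\<in>Poly_Mapping.keys p. Poly_Mapping.single \<alpha> (Poly_Mapping.lookup p \<alpha>))"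
    for p :: mpoly
    by (rule poly_mapping_eqI) (simp add: lookup_sum lookup_single when_def in_keys_iff)
  have single: "rescale c (Poly_Mapping.single \<alpha> a * Poly_Mapping.single \<beta> b) =
      rescale c (Poly_Mapping.single \<alpha> a) * rescale c (Poly_Mapping.single \<beta> b)" for \<alpha> \<beta> a b
    by (simp add: mult_single rescale_single monom_val_add mult_ac)
  show ?thesis
    by (subst (1 2) expand[of p], subst (1 2) expand[of q])
      (simp only: sum_product rescale_sum single)
qed

section \<open>Stability of the cones\<close>

text \<open>Only the support enters, which is why a positive factor and a rescaling change nothing.\<close>

lemma const_times_rescale_homogeneous:
  assumes "\<forall>i. c i > 0" "t > 0" "p \<in> homogeneous_polys n k"
  shows "Poly_Mapping.single 0 t * rescale c p \<in> homogeneous_polys n k"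
  using assms(3)
  by (simp add: homogeneous_polys_def polys_def keys_const_times_rescale[OF assms(1,2)])

text \<open>A positive factor \<open>t\<close> is moved into the squares: \<open>t q\<^sup>2 = (\<surd>t q)\<^sup>2\<close>.\<close>

lemma const_times_rescale_sos_le:
  assumes c: "\<forall>i. c i > 0" and t: "t > 0" and s: "s \<in> sos_le n k"
  shows "Poly_Mapping.single 0 t * rescale c s \<in> sos_le n k"
proof -
  from s obtain qs where le: "s \<in> polys_le n k"
    and qs: "set qs \<subseteq> polys n" "s = (\<Sum>q\<leftarrow>qs. q\<^sup>2)"
    by (auto simp: sos_le_def)
  define g where "g q = Poly_Mapping.single 0 (sqrt t) * rescale c q" for q
  have "Poly_Mapping.single 0 t * rescale c (q\<^sup>2) = (g q)\<^sup>2" for q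
  proof -
    have "(Poly_Mapping.single 0 t :: mpoly) = (Poly_Mapping.single 0 (sqrt t))\<^sup>2"
      using t by (simp add: power2_eq_square mult_single)
    moreover have "rescale c (q\<^sup>2) = (rescale c q)\<^sup>2"
      by (simp add: power2_eq_square rescale_mult)
    ultimately show ?thesis
      by (simp only: g_def power_mult_distrib)
  qed
  then have "Poly_Mapping.single 0 t * rescale c s = (\<Sum>q\<leftarrow>map g qs. q\<^sup>2)"
    by (simp add: qs(2) rescale_sum_list sum_list_const_mult[symmetric] o_def)
  moreover have "set (map g qs) \<subseteq> polys n"
    using qs(1) t by (auto simp: g_def polys_def subset_iff keys_const_times_rescale[OF c])
  moreover have "Poly_Mapping.single 0 t * rescale c s \<in> polys_le n k"
    using le by (simp add: polys_le_def polys_def keys_const_times_rescale[OF c t])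
  ultimately show ?thesis
    unfolding sos_le_def by blast
qed

lemma const_times_rescale_H_polys:
  assumes c: "\<forall>i. c i > 0" and t: "t > 0" and f: "f \<in> H_polys n r"
  shows "Poly_Mapping.single 0 t * rescale c f \<in> H_polys n r"
proof -
  let ?B = "{\<beta>. \<beta> \<in> exponents n \<and> mdeg \<beta> \<in> {r, r + 2}}"
  from f obtain \<sigma> where hom: "f \<in> homogeneous_polys n (r + 2)"
    and \<sigma>: "\<And>\<beta>. \<beta> \<in> ?B \<Longrightarrow> \<sigma> \<beta> \<in> sos_le n (r + 2 - mdeg \<beta>)"
    and feq: "f = (\<Sum>\<beta>\<in>?B. Poly_Mapping.single \<beta> 1 * \<sigma> \<beta>)"
    unfolding H_polys_def by blast
  \<comment> \<open>Rescaling \<open>x\<^sup>\<beta>\<close> produces the scalar \<open>c\<^sup>\<beta>\<close>, which is handed over to \<open>\<sigma>\<^sub>\<beta>\<close>.\<close>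
  define \<tau> where
    "\<tau> \<beta> = Poly_Mapping.single 0 (t * monom_val c \<beta>) * rescale c (\<sigma> \<beta>)" for \<beta>
  have term_eq: "Poly_Mapping.single 0 t * rescale c (Poly_Mapping.single \<beta> 1 * \<sigma> \<beta>) =
      Poly_Mapping.single \<beta> 1 * \<tau> \<beta>" for \<beta>
    by (simp add: \<tau>_def rescale_mult rescale_single mult_single mult.assoc[symmetric])
  have "Poly_Mapping.single 0 t * rescale c f = (\<Sum>\<beta>\<in>?B. Poly_Mapping.single \<beta> 1 * \<tau> \<beta>)"
    by (simp only: feq rescale_sum sum_distrib_left term_eq)
  moreover have "\<tau> \<beta> \<in> sos_le n (r + 2 - mdeg \<beta>)" if "\<beta> \<in> ?B" for \<beta>
    unfolding \<tau>_def using t monom_val_pos[OF c, of \<beta>]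
    by (intro const_times_rescale_sos_le[OF c _ \<sigma>[OF that]]) simp
  moreover have "Poly_Mapping.single 0 t * rescale c f \<in> homogeneous_polys n (r + 2)"
    by (rule const_times_rescale_homogeneous[OF c t hom])
  ultimately show ?thesis
    unfolding H_polys_def by blast
qed

section \<open>Diagonal scaling of the matrix\<close>

lemma diag_scaling_entry:
  assumes "M \<in> carrier_mat n n" "i < n" "j < n"
  shows "(mat_diag n c * M * mat_diag n c) $$ (i, j) = c i * M $$ (i, j) * c j"
  using assms by (simp add: mat_diag_mult_left[of _ n n] mat_diag_mult_right[of _ n n])

lemma diag_scaling_symmetric:
  assumes "M \<in> symmetric_mats n"
  shows "mat_diag n c * M * mat_diag n c \<in> symmetric_mats n"
proof -
  have M: "M \<in> carrier_mat n n" and "transpose_mat M = M"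
    using assms by (auto simp: symmetric_mats_def)
  then have sym: "M $$ (i, j) = M $$ (j, i)" if "i < n" "j < n" for i j
    using that by (metis carrier_matD index_transpose_mat(1))
  have carrier: "mat_diag n c * M * mat_diag n c \<in> carrier_mat n n"
    using M by (intro mult_carrier_mat) auto
  moreover have "transpose_mat (mat_diag n c * M * mat_diag n c) = mat_diag n c * M * mat_diag n c"
  proof (rule eq_matI, goal_cases)
    case (1 i j)
    then have "i < n" "j < n"
      using carrier by auto
    then show ?case
      using carrier sym diag_scaling_entry[OF M] by (simp del: index_mult_mat)
  qed (use carrier in \<open>auto simp del: index_mult_mat\<close>)
  ultimately show ?thesis
    by (simp add: symmetric_mats_def)
qed

lemma rescale_quad_form:
  assumes "M \<in> carrier_mat n n"
  shows "rescale c (quad_form n M) = quad_form n (mat_diag n c * M * mat_diag n c)"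
  unfolding quad_form_def rescale_sum
  by (intro sum.cong refl)
    (simp add: rescale_single monom_val_add monom_val_single diag_scaling_entry[OF assms] mult_ac
      del: index_mult_mat)

lemma diag_scaling_Q_tilde:
  assumes c: "\<forall>i. c i > 0" and "M \<in> Q_tilde n r"
  shows "mat_diag n c * M * mat_diag n c \<in> Q_tilde n r"
proof -
  from assms(2) obtain p where sym: "M \<in> symmetric_mats n" and p: "p \<in> N_polys n r"
    and norm: "coeff_norm1 p = 1" and H: "p * quad_form n M \<in> H_polys n r"
    by (auto simp: Q_tilde_def)
  then have M: "M \<in> carrier_mat n n"
    by (simp add: symmetric_mats_def)
  define N where "N = coeff_norm1 (rescale c p)"
  have "Poly_Mapping.keys p \<noteq> {}"
    using norm by (auto simp: coeff_norm1_def)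
  then have N: "N > 0"
    unfolding N_def coeff_norm1_def by (intro sum_pos) (auto simp: keys_rescale[OF c] in_keys_iff
      lookup_rescale monom_val_pos[OF c] less_imp_neq[OF monom_val_pos[OF c], symmetric])
  \<comment> \<open>The rescaled multiplier may have any positive norm, so it has to be normalised again.\<close>
  define q where "q = Poly_Mapping.single 0 (1 / N) * rescale c p"
  have "q \<in> homogeneous_polys n r"
    using p N unfolding q_def
    by (intro const_times_rescale_homogeneous[OF c]) (auto simp: N_polys_def)
  moreover have "Poly_Mapping.lookup q \<beta> \<ge> 0" for \<beta>
    using p N monom_val_pos[OF c, of \<beta>]
    by (simp add: q_def lookup_const_times lookup_rescale N_polys_def)
  ultimately have "q \<in> N_polys n r"
    by (simp add: N_polys_def)
  moreover have "coeff_norm1 q = 1"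
  proof -
    have "Poly_Mapping.keys q = Poly_Mapping.keys (rescale c p)"
      using N by (simp add: q_def keys_const_times_rescale[OF c] keys_rescale[OF c])
    then have "coeff_norm1 q = coeff_norm1 (rescale c p) / N"
      using N by (simp add: coeff_norm1_def q_def lookup_const_times abs_mult sum_divide_distrib)
    then show ?thesis
      using N by (simp add: N_def)
  qed
  moreover have "q * quad_form n (mat_diag n c * M * mat_diag n c) \<in> H_polys n r"
    using const_times_rescale_H_polys[OF c _ H, of "1 / N"] N
    by (simp add: q_def rescale_mult rescale_quad_form[OF M] mult.assoc)
  ultimately show ?thesis
    using diag_scaling_symmetric[OF sym] unfolding Q_tilde_def by blast
qed

theorem proposition3p3:
  fixes n r :: nat and d :: "nat \<Rightarrow> real" and M :: "real mat"
  assumes "\<forall>i<n. d i > 0"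
    and "M \<in> symmetric_mats n"
  shows "M \<in> Q_tilde n r \<longleftrightarrow> mat_diag n d * M * mat_diag n d \<in> Q_tilde n r"
proof -
  \<comment> \<open>Values of \<open>d\<close> from index \<open>n\<close> on do not affect the matrix, so they may be made positive.\<close>
  define c where "c i = (if i < n then d i else 1)" for i
  have c: "\<forall>i. c i > 0"
    using assms(1) by (simp add: c_def)
  have D: "mat_diag n d = mat_diag n c"
    by (rule eq_matI) (auto simp: mat_diag_def c_def)
  have M: "M \<in> carrier_mat n n"
    using assms(2) by (simp add: symmetric_mats_def)
  let ?N = "mat_diag n c * M * mat_diag n c"
  have N: "?N \<in> carrier_mat n n"
    using M by (intro mult_carrier_mat) auto
  have inverse: "mat_diag n (\<lambda>i. 1 / c i) * ?N * mat_diag n (\<lambda>i. 1 / c i) = M"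
  proof (rule eq_matI, goal_cases)
    case (1 i j)
    then have "i < n" "j < n"
      using M by auto
    then show ?case
      using c[rule_format, of i] c[rule_format, of j] by (simp add: diag_scaling_entry[OF N] diag_scaling_entry[OF M]
        del: index_mult_mat)
  qed (use M in \<open>auto simp: mat_diag_def\<close>)
  show ?thesis
    unfolding D
  proof
    show "?N \<in> Q_tilde n r" if "M \<in> Q_tilde n r"
      using diag_scaling_Q_tilde[OF c that] .
    show "M \<in> Q_tilde n r" if "?N \<in> Q_tilde n r"
      using diag_scaling_Q_tilde[of "\<lambda>i. 1 / c i", OF _ that] c by (simp add: inverse)
  qed
qed

end
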